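(* Let $p<q<r$ be odd primes, $n=pqr$ and $m=\phi(n)$. Then $$\mathrm{Cond}(V_{\Phi_n})\le 2m^4.$$
   Context: $\phi$ is Euler's totient, $\Phi_n$ is the $n$-th cyclotomic polynomial, of degree $m=\phi(n)$, and $\zeta_1,\dots,\zeta_m\in\mathbb{C}$ are the primitive $n$-th roots of unity (in any fixed order). $V_{\Phi_n}$ is the $m\times m$ Vandermonde matrix whose $(i,j)$ entry is $\zeta_i^{\,j-1}$, $1\le i,j\le m$. For a complex matrix $A=(a_{ij})$, $\|A\|=\sqrt{\sum_{i,j}|a_{ij}|^2}$ is the Frobenius norm, and for invertible $A$, $\mathrm{Cond}(A)=\|A\|\,\|A^{-1}\|$. *)

theory Defs
  imports
    "HOL-Number_Theory.Totient"
    "Jordan_Normal_Form.Gauss_Jordan_Elimination"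
    "Jordan_Normal_Form.Determinant"
begin

definition primitive_roots_of_unity :: "nat \<Rightarrow> complex set" where
  "primitive_roots_of_unity n = {z. z ^ n = 1 \<and> (\<forall>k. 0 < k \<and> k < n \<longrightarrow> z ^ k \<noteq> 1)}"

text \<open>Rows and columns are numbered from \<open>0\<close>, so that the exponent is the column index itself.\<close>

definition vandermonde_mat :: "nat \<Rightarrow> (nat \<Rightarrow> complex) \<Rightarrow> complex mat" where
  "vandermonde_mat m \<zeta> = mat m m (\<lambda>(i, j). \<zeta> i ^ j)"

definition frobenius_norm :: "complex mat \<Rightarrow> real" where
  "frobenius_norm A = sqrt (\<Sum>i<dim_row A. \<Sum>j<dim_col A. (cmod (A $$ (i, j)))\<^sup>2)"

text \<open>
  Only meaningful for invertible matrices: otherwise \<open>mat_inverse A\<close> is \<open>None\<close>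
  and the value is unspecified. The lemma below shows that this does not happen for
  Vandermonde matrices with distinct nodes.
\<close>

definition cond_number :: "complex mat \<Rightarrow> real" where
  "cond_number A = frobenius_norm A * frobenius_norm (the (mat_inverse A))"

lemma vandermonde_mat_inverse:
  assumes inj: "inj_on \<zeta> {..<m}"
  obtains B where "mat_inverse (vandermonde_mat m \<zeta>) = Some B" "B \<in> carrier_mat m m"
    "vandermonde_mat m \<zeta> * B = 1\<^sub>m m" "B * vandermonde_mat m \<zeta> = 1\<^sub>m m"
proof -
  let ?V = "vandermonde_mat m \<zeta>"
  have V: "?V \<in> carrier_mat m m" by (simp add: vandermonde_mat_def)
  have "det ?V \<noteq> 0"
  proof
    assume "det ?V = 0"
    then obtain v where v: "v \<in> carrier_vec m" "v \<noteq> 0\<^sub>v m" "?V *\<^sub>v v = 0\<^sub>v m"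
      using det_0_iff_vec_prod_zero[OF V] by blast
    define p where "p = (\<Sum>j<m. monom (v $ j) j)"
    have coeff: "coeff p j = (if j < m then v $ j else 0)" for j
      by (simp add: p_def coeff_sum)
    have root: "poly p (\<zeta> i) = 0" if "i < m" for i
    proof -
      have "(?V *\<^sub>v v) $ i = 0" using v(3) that by simp
      moreover have "(?V *\<^sub>v v) $ i = (\<Sum>j<m. \<zeta> i ^ j * v $ j)"
        using that v(1) by (auto simp: vandermonde_mat_def scalar_prod_def lessThan_atLeast0)
      ultimately show ?thesis by (simp add: p_def poly_sum poly_monom mult.commute)
    qed
    have "p \<noteq> 0"
    proof
      assume "p = 0"
      then have "v $ j = 0" if "j < m" for j using coeff[of j] that by simp
      then have "v = 0\<^sub>v m" using v(1) by auto
      then show False using v(2) by simp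
    qed
    then have "coeff p (degree p) \<noteq> 0" by simp
    then have "degree p < m" using coeff[of "degree p"] by (auto split: if_splits)
    moreover have "m \<le> card {z. poly p z = 0}"
      using card_mono[OF poly_roots_finite[OF \<open>p \<noteq> 0\<close>], of "\<zeta> ` {..<m}"] root
      by (auto simp: card_image[OF inj])
    ultimately show False using card_poly_roots_bound[OF \<open>p \<noteq> 0\<close>] by simp
  qed
  then have "?V \<in> Units (ring_mat TYPE(complex) m ())"
    by (rule det_non_zero_imp_unit[OF V])
  then obtain B where "mat_inverse ?V = Some B"
    using mat_inverse(1)[OF V, of "()"] by (cases "mat_inverse ?V") auto
  then show thesis using mat_inverse(2)[OF V] that by blast
qed

end

theory Submission
  imports
    Defs
    "HOL-Computational_Algebra.Polynomial_FPS"
begin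

text \<open>
  The columns of the inverse of the Vandermonde matrix are the coefficient vectors of
  \<open>L(x) / L(\<zeta>)\<close> with \<open>L(x) = \<Phi>\<^sub>n(x) / (x - \<zeta>)\<close>. Since \<open>|\<zeta>| = 1\<close>, synthetic division bounds the
  coefficients of \<open>L\<close> by \<open>m\<close> times those of \<open>\<Phi>\<^sub>n\<close>, and the latter are at most \<open>pq\<close> because
  \<open>\<Phi>\<^sub>n(x) = \<Phi>\<^bsub>pq\<^esub>(x\<^sup>r) / \<Phi>\<^bsub>pq\<^esub>(x)\<close>. In the other direction \<open>|L(\<zeta>)| = n / |\<Psi>(\<zeta>)|\<close>, where
  \<open>\<Psi>(x) = (x\<^sup>n - 1) / \<Phi>\<^sub>n(x) = (x\<^bsup>qr\<^esup> - 1) (x\<^bsup>pr\<^esup> - 1) / (x\<^sup>r - 1) \<Phi>\<^bsub>pq\<^esub>(x)\<close> has modulus at most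
  \<open>2p \<cdot> pq\<close> at \<open>\<zeta>\<close>. As \<open>pq \<le> m\<close>, every entry of the inverse has modulus at most \<open>2m\<^sup>2\<close>.
\<close>

section \<open>Polynomials with prescribed simple roots\<close>

text \<open>Cyclotomic polynomials and their complementary factors are all encoded by their sets of
  roots, so that identities between them reduce to set algebra on roots of unity.\<close>

definition root_poly :: "complex set \<Rightarrow> complex poly" where
  "root_poly A = (\<Prod>z\<in>A. [:- z, 1:])"

abbreviation unity_roots :: "nat \<Rightarrow> complex set" where
  "unity_roots k \<equiv> {z. z ^ k = 1}"

abbreviation unity_poly :: "nat \<Rightarrow> complex poly" where
  "unity_poly k \<equiv> monom 1 k - 1"

lemma poly_root_poly: "poly (root_poly A) x = (\<Prod>z\<in>A. x - z)"
  by (simp add: root_poly_def poly_prod)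

lemma root_poly_nonzero: "finite A \<Longrightarrow> root_poly A \<noteq> 0"
  by (simp add: root_poly_def)

lemma degree_root_poly: "finite A \<Longrightarrow> degree (root_poly A) = card A"
  by (simp add: root_poly_def degree_prod_sum_eq)

lemma lead_coeff_root_poly: "lead_coeff (root_poly A) = 1"
  by (simp add: root_poly_def lead_coeff_prod)

lemma root_poly_disjoint_union:
  "finite A \<Longrightarrow> finite B \<Longrightarrow> A \<inter> B = {} \<Longrightarrow> root_poly (A \<union> B) = root_poly A * root_poly B"
  by (simp add: root_poly_def prod.union_disjoint)

lemma root_poly_union_inter:
  "finite A \<Longrightarrow> finite B \<Longrightarrow> root_poly (A \<union> B) * root_poly (A \<inter> B) = root_poly A * root_poly B"
  by (simp add: root_poly_def prod.union_inter)

lemma root_poly_remove: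
  "finite A \<Longrightarrow> z \<in> A \<Longrightarrow> root_poly A = [:- z, 1:] * root_poly (A - {z})"
  unfolding root_poly_def by (rule prod.remove)

lemma finite_unity_roots: "0 < k \<Longrightarrow> finite (unity_roots k)"
  by (rule finite_roots_unity) simp

text \<open>Both sides have degree at most \<open>k\<close>, share the coefficient of x^k and agree
  at the \<open>k\<close> roots of unity, so their difference has too many zeros for its
  degree.\<close>

lemma root_poly_unity_roots:
  assumes "0 < k"
  shows "root_poly (unity_roots k) = unity_poly k"
proof (rule poly_eqI_degree_lead_coeff[of _ k _ "unity_roots k"])
  have card: "card (unity_roots k) = k"
    using assms by (rule card_roots_unity_eq)
  have deg: "degree (root_poly (unity_roots k)) = k"
    using card finite_unity_roots[OF assms] by (simp add: degree_root_poly)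
  show "coeff (root_poly (unity_roots k)) k = coeff (unity_poly k) k"
    using lead_coeff_root_poly[of "unity_roots k"] deg assms by simp
  show "k \<le> card (unity_roots k)" "degree (root_poly (unity_roots k)) \<le> k"
    using card deg by simp_all
  show "degree (unity_poly k) \<le> k"
    by (rule degree_diff_le) (simp_all add: degree_monom_le)
  show "poly (root_poly (unity_roots k)) z = poly (unity_poly k) z" if "z \<in> unity_roots k" for z
    using that finite_unity_roots[OF assms] by (auto simp: poly_root_poly poly_monom)
qed

lemma unity_poly_nonzero: "0 < k \<Longrightarrow> unity_poly k \<noteq> 0"
  using root_poly_nonzero[OF finite_unity_roots] root_poly_unity_roots by metis

lemma degree_unity_poly:
  assumes "0 < k"
  shows "degree (unity_poly k) = k"
  using assms degree_root_poly[OF finite_unity_roots] root_poly_unity_roots card_roots_unity_eq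
  by metis

text \<open>By Bezout the gcd is a difference of a multiple of \<open>a\<close> and a multiple of
  \<open>b\<close>; the converse is divisibility of exponents.\<close>

lemma unity_roots_inter:
  assumes "0 < a"
  shows "unity_roots a \<inter> unity_roots b = unity_roots (gcd a b)"
proof (intro equalityI subsetI)
  fix z :: complex
  assume z: "z \<in> unity_roots a \<inter> unity_roots b"
  obtain x y where "a * x = b * y + gcd a b"
    using bezout_nat assms by blast
  then have "(z ^ a) ^ x = (z ^ b) ^ y * z ^ gcd a b"
    by (metis power_add power_mult)
  with z show "z \<in> unity_roots (gcd a b)" by simp
next
  fix z :: complex
  assume "z \<in> unity_roots (gcd a b)"
  then show "z \<in> unity_roots a \<inter> unity_roots b"
    by (metis (mono_tags, lifting) IntI dvdE gcd_dvd1 gcd_dvd2 mem_Collect_eq power_mult power_one)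
qed

text \<open>If z^k = 1 for some 0 < k < pqr, then also z^g = 1 for the proper divisor g = gcd(k,
  pqr). Stripping one prime from the cofactor of g shows that g divides one of qr, pr, pq.\<close>

lemma primitive_roots_of_unity_three_primes:
  assumes "prime p" "prime q" "prime r"
  shows "primitive_roots_of_unity (p * q * r) =
    unity_roots (p * q * r) - (unity_roots (p * q) \<union> (unity_roots (p * r) \<union> unity_roots (q * r)))"
    (is "?P = ?R")
proof (intro equalityI subsetI)
  have gt: "1 < p" "1 < q" "1 < r" using assms prime_gt_1_nat by auto
  have lt: "0 < p * q" "p * q < p * q * r" "0 < p * r" "p * r < p * q * r"
      "0 < q * r" "q * r < p * q * r"
    using gt by (auto simp: mult.assoc)
  fix z assume "z \<in> ?P"
  then show "z \<in> ?R" using lt by (auto simp: primitive_roots_of_unity_def)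
next
  fix z assume z: "z \<in> ?R"
  have "z ^ k \<noteq> 1" if k: "0 < k" "k < p * q * r" for k
  proof
    assume "z ^ k = 1"
    define g where "g = gcd k (p * q * r)"
    have zg: "z ^ g = 1"
      using unity_roots_inter[OF k(1), of "p * q * r"] \<open>z ^ k = 1\<close> z unfolding g_def by blast
    have pow: "z ^ (g * c) = 1" for c using zg by (simp add: power_mult)
    obtain c where c: "p * q * r = g * c"
      unfolding g_def by (meson dvdE gcd_dvd2)
    have "g \<le> k" unfolding g_def using k by (simp add: gcd_le1_nat)
    with c k(2) have "c \<noteq> 1" by auto
    then obtain s where s: "prime s" "s dvd c" using prime_factor_nat by blast
    then obtain d where d: "c = s * d" by (elim dvdE)
    have "s dvd p * q * r" using c s(2) by simp
    then consider "s = p" | "s = q" | "s = r"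
      using s(1) assms by (metis prime_dvd_mult_nat primes_dvd_imp_eq)
    then show False
    proof cases
      case 1
      then have "q * r = g * d" using c d assms(1) by (auto simp: prime_gt_0_nat ac_simps)
      then show False using z pow[of d] by simp
    next
      case 2
      then have "p * r = g * d" using c d assms(2) by (auto simp: prime_gt_0_nat ac_simps)
      then show False using z pow[of d] by simp
    next
      case 3
      then have "p * q = g * d" using c d assms(3) by (auto simp: prime_gt_0_nat ac_simps)
      then show False using z pow[of d] by simp
    qed
  qed
  then show "z \<in> ?P" using z by (simp add: primitive_roots_of_unity_def)
qed

section \<open>Coefficients of quotients of products of binomials\<close>

text \<open>For positive \<open>d\<close> this is the geometric series 1 / (1 - x^d).\<close>

abbreviation multiples_fps :: "nat \<Rightarrow> complex fps" where
  "multiples_fps d \<equiv> Abs_fps (\<lambda>k. of_bool (d dvd k))"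

lemma one_minus_X_power_nonzero: "0 < d \<Longrightarrow> (1 - fps_X ^ d :: complex fps) \<noteq> 0"
proof
  assume "0 < d"
  then have "fps_nth (1 - fps_X ^ d :: complex fps) 0 = 1" by simp
  moreover assume "(1 - fps_X ^ d :: complex fps) = 0"
  ultimately show False by (metis fps_zero_nth zero_neq_one)
qed

lemma one_minus_X_power_times_multiples_fps:
  assumes "0 < d"
  shows "(1 - fps_X ^ d) * multiples_fps d = 1"
proof (rule fps_ext)
  fix k
  show "fps_nth ((1 - fps_X ^ d) * multiples_fps d) k = fps_nth 1 k"
    using assms by (auto simp: algebra_simps fps_X_power_mult_nth dvd_minus_self dest: dvd_imp_le)
qed

lemma one_minus_X_power_times_geometric_sum:
  "(1 - fps_X ^ a) * (\<Sum>i<N. fps_X ^ (a * i)) = (1 - fps_X ^ (a * N) :: complex fps)"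
  by (simp add: power_mult one_diff_power_eq)

text \<open>The coefficient at \<open>k\<close> counts the i < N with a i \<le> k and a i congruent
  to k modulo d; distinct residues leave at most one such i.\<close>

lemma geometric_sum_times_multiples_fps_nth:
  assumes "inj_on (\<lambda>i. a * i mod d) {..<N}"
  shows "fps_nth ((\<Sum>i<N. fps_X ^ (a * i)) * multiples_fps d) k \<in> {0, 1}"
proof -
  define I where "I = {i \<in> {..<N}. a * i \<le> k \<and> d dvd k - a * i}"
  have "fps_nth ((\<Sum>i<N. fps_X ^ (a * i)) * multiples_fps d) k =
      (\<Sum>i<N. if a * i \<le> k \<and> d dvd k - a * i then 1 else 0)"
    by (simp add: sum_distrib_right fps_sum_nth fps_X_power_mult_nth cong: if_cong)
      (intro sum.cong refl, auto)
  also have "\<dots> = of_nat (card I)"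
    by (simp add: I_def sum.If_cases Int_def)
  finally have eq: "fps_nth ((\<Sum>i<N. fps_X ^ (a * i)) * multiples_fps d) k = of_nat (card I)" .
  have "i = j" if "i \<in> I" "j \<in> I" for i j
  proof -
    have "a * i mod d = k mod d" "a * j mod d = k mod d"
      using that unfolding I_def by (metis (lifting) mem_Collect_eq mod_eq_dvd_iff_nat)+
    then show ?thesis using that inj_onD[OF assms, of i j] by (auto simp: I_def)
  qed
  then have "card I \<le> 1" by (simp add: card_le_Suc0_iff_eq I_def)
  then show ?thesis using eq by (cases "card I") auto
qed

text \<open>A difference of two numbers in \<open>{0, 1}\<close> lies in \<open>{-1, 0, 1}\<close>.\<close>

lemma flat_fps:
  assumes "inj_on (\<lambda>i. a * i mod d) {..<N}"
  shows "norm (fps_nth ((1 - fps_X ^ c) * ((\<Sum>i<N. fps_X ^ (a * i)) * multiples_fps d)) k) \<le> 1"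
proof -
  define T where "T = (\<Sum>i<N. fps_X ^ (a * i)) * multiples_fps d"
  have "fps_nth T j \<in> {0, 1}" for j
    unfolding T_def by (rule geometric_sum_times_multiples_fps_nth[OF assms])
  from this[of k] this[of "k - c"] show ?thesis
    unfolding T_def[symmetric] by (auto simp: left_diff_distrib fps_X_power_mult_nth)
qed

lemma inj_on_mult_mod:
  fixes p q :: nat
  assumes "coprime p q"
  shows "inj_on (\<lambda>i. p * i mod q) {..<q}"
proof (rule inj_onI)
  fix i j assume ij: "i \<in> {..<q}" "j \<in> {..<q}" and "p * i mod q = p * j mod q"
  then have "[p * i = p * j] (mod q)" by (simp add: cong_def)
  then have "[i = j] (mod q)" using assms by (simp add: cong_mult_lcancel_nat)
  then show "i = j" using ij by (simp add: cong_def)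
qed

section \<open>Cyclotomic polynomials of order a product of two or three primes\<close>

text \<open>For distinct primes this is \<Phi>_pq; the lemmas below treat coprime \<open>p\<close>
  and \<open>q\<close>.\<close>

definition binary_cyclotomic :: "nat \<Rightarrow> nat \<Rightarrow> complex poly" where
  "binary_cyclotomic p q = root_poly (unity_roots (p * q) - (unity_roots p \<union> unity_roots q))"

text \<open>This is \<Phi>_pq = (x - 1)(x^pq - 1) / ((x^p - 1)(x^q - 1)) cleared of denominators.
  The factor x - 1 corrects for the root 1, the only one common to x^p - 1 and x^q - 1.\<close>

lemma binary_cyclotomic_mult:
  assumes "coprime p q" "0 < p" "0 < q"
  shows "binary_cyclotomic p q * unity_poly p * unity_poly q = unity_poly 1 * unity_poly (p * q)"
proof -
  let ?U = "unity_roots p \<union> unity_roots q"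
  have fin: "finite (unity_roots p)" "finite (unity_roots q)" "finite (unity_roots (p * q))"
    using assms by (simp_all add: finite_unity_roots)
  have sub: "?U \<subseteq> unity_roots (p * q)" by (auto simp: power_mult power_commutes) (metis mult.commute power_mult power_one)
  have inter: "unity_roots p \<inter> unity_roots q = unity_roots 1"
    using unity_roots_inter[of p q] assms by simp
  have "root_poly (unity_roots 1) = unity_poly 1" by (rule root_poly_unity_roots) simp
  with root_poly_union_inter[OF fin(1,2), unfolded inter]
  have U: "unity_poly p * unity_poly q = root_poly ?U * unity_poly 1"
    unfolding root_poly_unity_roots[OF assms(2)] root_poly_unity_roots[OF assms(3)] by (simp only:)
  have "binary_cyclotomic p q * root_poly ?U = unity_poly (p * q)"
  proof -
    have "binary_cyclotomic p q * root_poly ?U = root_poly (unity_roots (p * q) - ?U \<union> ?U)"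
      unfolding binary_cyclotomic_def using fin by (intro root_poly_disjoint_union[symmetric]) auto
    also have "unity_roots (p * q) - ?U \<union> ?U = unity_roots (p * q)" using sub by blast
    finally show ?thesis using assms by (simp add: root_poly_unity_roots)
  qed
  from this[symmetric] U show ?thesis by (simp only: ac_simps)
qed

text \<open>Comparing degrees in the product formula gives (p - 1)(q - 1). The weaker bound says
  that there are at most pq coefficients, which is how it enters the later estimates.\<close>

lemma degree_binary_cyclotomic:
  assumes "coprime p q" "1 < p" "1 < q"
  shows "degree (binary_cyclotomic p q) < p * q"
proof -
  have "binary_cyclotomic p q \<noteq> 0"
    unfolding binary_cyclotomic_def using assms
    by (intro root_poly_nonzero finite_Diff finite_unity_roots) simp
  moreover have "degree (binary_cyclotomic p q * unity_poly p * unity_poly q) =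
      degree (unity_poly 1 * unity_poly (p * q))"
    using binary_cyclotomic_mult assms by simp
  moreover have "unity_poly k \<noteq> 0" "degree (unity_poly k) = k" if "k \<in> {1, p, q, p * q}" for k
  proof -
    have "0 < k" using that assms by auto
    then show "unity_poly k \<noteq> 0" "degree (unity_poly k) = k"
      by (rule unity_poly_nonzero, rule degree_unity_poly)
  qed
  ultimately have "degree (binary_cyclotomic p q) + p + q = 1 + p * q"
    by (simp only: degree_mult_eq mult_eq_0_iff insert_iff simp_thms)
  with assms show ?thesis by linarith
qed

lemma fps_of_unity_poly: "fps_of_poly (unity_poly k) = - (1 - fps_X ^ k)"
  by (simp add: fps_of_poly_diff fps_of_poly_monom')

text \<open>As a power series, \<Phi>_pq = (1 - x)(1 + x^p + ... + x^(p(q-1))) / (1 - x^q). The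
  multiples of p in the sum are distinct modulo q, so \<open>flat_fps\<close> applies.\<close>

lemma coeff_binary_cyclotomic:
  assumes "coprime p q" "0 < p" "0 < q"
  shows "norm (coeff (binary_cyclotomic p q) k) \<le> 1"
proof -
  define F where "F = fps_of_poly (binary_cyclotomic p q)"
  define S where "S = (\<Sum>i<q. fps_X ^ (p * i) :: complex fps)"
  have "F * fps_of_poly (unity_poly p) * fps_of_poly (unity_poly q) =
      fps_of_poly (unity_poly 1) * fps_of_poly (unity_poly (p * q))"
    unfolding F_def fps_of_poly_mult[symmetric] binary_cyclotomic_mult[OF assms] ..
  \<comment> \<open>Each side has two factors x^k - 1, so replacing them by 1 - x^k leaves no
    sign.\<close>
  then have "F * (1 - fps_X ^ p) * (1 - fps_X ^ q) = (1 - fps_X ^ 1) * (1 - fps_X ^ (p * q))"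
    unfolding fps_of_unity_poly
    by (simp only: minus_mult_left[symmetric] minus_mult_right[symmetric] minus_minus mult_1)
  also have "\<dots> = (1 - fps_X ^ 1) * ((1 - fps_X ^ p) * S)"
    unfolding S_def one_minus_X_power_times_geometric_sum ..
  finally have "(1 - fps_X ^ p) * (F * (1 - fps_X ^ q)) = (1 - fps_X ^ p) * ((1 - fps_X ^ 1) * S)"
    by (simp only: ac_simps)
  then have "F * (1 - fps_X ^ q) = (1 - fps_X ^ 1) * S"
    using one_minus_X_power_nonzero[OF assms(2)] by (simp del: power_one_right)
  then have "F * ((1 - fps_X ^ q) * multiples_fps q) = (1 - fps_X ^ 1) * (S * multiples_fps q)"
    by (simp only: mult.assoc[symmetric])
  then have "F = (1 - fps_X ^ 1) * (S * multiples_fps q)"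
    unfolding one_minus_X_power_times_multiples_fps[OF assms(3)] by simp
  then have "coeff (binary_cyclotomic p q) k = fps_nth ((1 - fps_X ^ 1) * (S * multiples_fps q)) k"
    unfolding F_def by (metis fps_of_poly_nth)
  then show ?thesis
    unfolding S_def using flat_fps[OF inj_on_mult_mod[OF assms(1)], of 1] by metis
qed

lemma norm_poly_le:
  fixes f :: "'a::real_normed_field poly"
  assumes "\<And>k. norm (coeff f k) \<le> c" "norm z = 1"
  shows "norm (poly f z) \<le> (real (degree f) + 1) * c"
proof -
  have "norm (poly f z) \<le> (\<Sum>k\<le>degree f. norm (coeff f k * z ^ k))"
    unfolding poly_altdef by (rule norm_sum)
  also have "\<dots> \<le> (\<Sum>k\<le>degree f. c)"
    using assms by (intro sum_mono) (simp add: norm_mult norm_power)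
  finally show ?thesis by (simp add: add.commute)
qed

text \<open>\<open>\<Phi>\<^bsub>pqr\<^esub>(x) = \<Phi>\<^bsub>pq\<^esub>(x\<^sup>r) / \<Phi>\<^bsub>pq\<^esub>(x)\<close>, and \<open>1 / \<Phi>\<^bsub>pq\<^esub>\<close> is again a flat power series.\<close>

lemma coeff_ternary_cyclotomic:
  fixes P :: "complex poly"
  assumes "coprime p q" "1 < p" "1 < q" "0 < r"
    and P: "P * binary_cyclotomic p q = pcompose (binary_cyclotomic p q) (monom 1 r)"
  shows "norm (coeff P k) \<le> real (p * q)"
proof -
  define R where "R = binary_cyclotomic p q"
  define Rr where "Rr = fps_of_poly (pcompose R (monom 1 r))"
  define F where "F = fps_of_poly P"
  define S where "S = (\<Sum>i<p. fps_X ^ (1 * i) :: complex fps)"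
  \<comment> \<open>\<open>S\<close> is (1 - x^p) / (1 - x), hence \<open>W\<close> is the power
    series 1 / \<Phi>_pq in the shape required by \<open>flat_fps\<close>, with step 1 and modulus
    pq.\<close>
  define W where "W = (1 - fps_X ^ q) * (S * multiples_fps (p * q))"
  have pos: "0 < p" "0 < q" "0 < p * q" using assms by auto
  have RX: "R * unity_poly p * unity_poly q = unity_poly 1 * unity_poly (p * q)"
    unfolding R_def by (rule binary_cyclotomic_mult[OF assms(1) pos(1,2)])
  have "P * (unity_poly 1 * unity_poly (p * q)) =
      pcompose R (monom 1 r) * unity_poly p * unity_poly q"
    using P unfolding RX[symmetric] R_def[symmetric] by (simp only: mult.assoc[symmetric])
  then have "F * fps_of_poly (unity_poly 1) * fps_of_poly (unity_poly (p * q)) =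
      Rr * fps_of_poly (unity_poly p) * fps_of_poly (unity_poly q)"
    unfolding F_def Rr_def fps_of_poly_mult[symmetric] by (simp only: mult.assoc)
  then have "F * (1 - fps_X ^ 1) * (1 - fps_X ^ (p * q)) = Rr * (1 - fps_X ^ (1 * p)) * (1 - fps_X ^ q)"
    unfolding fps_of_unity_poly
    by (simp only: minus_mult_left[symmetric] minus_mult_right[symmetric] minus_minus mult_1)
  also have "\<dots> = Rr * ((1 - fps_X ^ 1) * S) * (1 - fps_X ^ q)"
    unfolding S_def one_minus_X_power_times_geometric_sum ..
  finally have "(1 - fps_X ^ 1) * (F * (1 - fps_X ^ (p * q))) =
      (1 - fps_X ^ 1) * (Rr * S * (1 - fps_X ^ q))"
    by (simp only: ac_simps)
  then have "F * (1 - fps_X ^ (p * q)) = Rr * S * (1 - fps_X ^ q)"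
    using one_minus_X_power_nonzero[of 1] by (simp del: power_one_right)
  from arg_cong[OF this, of "\<lambda>f. f * multiples_fps (p * q)"]
  have "F * ((1 - fps_X ^ (p * q)) * multiples_fps (p * q)) = Rr * W"
    unfolding W_def by (simp only: ac_simps)
  then have F: "F = Rr * W"
    unfolding one_minus_X_power_times_multiples_fps[OF pos(3)] by simp
  have "p \<le> p * q" using pos by simp
  then have "inj_on (\<lambda>i. 1 * i mod (p * q)) {..<p}"
    by (intro inj_onI) (metis lessThan_iff mod_less mult_1 order_less_le_trans)
  then have W1: "norm (fps_nth W j) \<le> 1" for j
    unfolding W_def S_def by (rule flat_fps)
  have R1: "norm (coeff R j) \<le> 1" for j
    unfolding R_def by (rule coeff_binary_cyclotomic[OF assms(1) pos(1,2)])
  have "pcompose R (monom 1 r) = (\<Sum>j\<le>degree R. monom (coeff R j) (r * j))"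
    by (intro iffD1[OF poly_eq_poly_eq_iff] ext)
      (simp add: poly_pcompose poly_sum poly_monom poly_altdef[of R] power_mult)
  then have "Rr * W = (\<Sum>j\<le>degree R. fps_const (coeff R j) * (fps_X ^ (r * j) * W))"
    unfolding Rr_def by (simp add: fps_of_poly_sum fps_of_poly_monom sum_distrib_right mult.assoc)
  then have "coeff P k =
      fps_nth (\<Sum>j\<le>degree R. fps_const (coeff R j) * (fps_X ^ (r * j) * W)) k"
    using arg_cong[OF F, of "\<lambda>f. fps_nth f k"] unfolding F_def by (simp only: fps_of_poly_nth)
  also have "\<dots> = (\<Sum>j\<le>degree R. coeff R j * (if k < r * j then 0 else fps_nth W (k - r * j)))"
    by (simp only: fps_sum_nth fps_mult_left_const_nth fps_X_power_mult_nth)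
  \<comment> \<open>Every term c x^(rj) of \<Phi>_pq(x^r) contributes one shifted coefficient of
    \<open>W\<close>, of modulus at most 1, and there are at most pq terms.\<close>
  also have "norm \<dots> \<le> (\<Sum>j\<le>degree R. 1)"
    using R1 W1 by (intro sum_norm_le) (auto simp: norm_mult intro!: mult_le_one)
  also have "\<dots> \<le> real (p * q)"
    using degree_binary_cyclotomic[OF assms(1-3)] unfolding R_def by (simp del: of_nat_mult)
  finally show ?thesis .
qed


text \<open>\<open>A\<close> collects the nonprimitive roots, so \<open>root_poly A\<close> is
  \<Psi>. The first identity yields the derivative at a node, the second bounds \<Psi> there, and
  the third feeds the coefficient bound for \<Phi>_n.\<close>

lemma ternary_root_poly_factors:
  assumes cop: "coprime p q" "coprime p r" "coprime q r" and pos: "0 < p" "0 < q" "0 < r"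
  defines "A \<equiv> unity_roots (p * q) \<union> (unity_roots (p * r) \<union> unity_roots (q * r))"
  shows "root_poly (unity_roots (p * q * r) - A) * root_poly A = unity_poly (p * q * r)" (is ?full)
    and "root_poly A * unity_poly r =
      binary_cyclotomic p q * unity_poly (p * r) * unity_poly (q * r)" (is ?nonprimitive)
    and "root_poly (unity_roots (p * q * r) - A) * binary_cyclotomic p q =
      pcompose (binary_cyclotomic p q) (monom 1 r)" (is ?primitive)
proof -
  define P where "P = root_poly (unity_roots (p * q * r) - A)"
  define R where "R = binary_cyclotomic p q"
  let ?D = "unity_roots (p * r) \<union> unity_roots (q * r)"
  have fin: "finite (unity_roots (p * q))" "finite (unity_roots (p * r))"
      "finite (unity_roots (q * r))" "finite (unity_roots (p * q * r))"
    using pos by (simp_all add: finite_unity_roots)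
  have sub: "unity_roots a \<subseteq> unity_roots b" if "a dvd b" for a b
    using that by (auto simp: power_mult elim!: dvdE)
  have "A \<subseteq> unity_roots (p * q * r)"
    unfolding A_def by (intro Un_least sub) auto
  then have "unity_roots (p * q * r) - A \<union> A = unity_roots (p * q * r)" by blast
  moreover have "finite A" unfolding A_def using fin by blast
  ultimately have "P * root_poly A = root_poly (unity_roots (p * q * r))"
    unfolding P_def by (metis Diff_disjoint fin(4) finite_Diff inf_commute root_poly_disjoint_union)
  then have full: "P * root_poly A = unity_poly (p * q * r)"
    using pos by (simp add: root_poly_unity_roots)
  then show ?full unfolding P_def .

  have gcds: "gcd (p * r) (q * r) = r" "gcd (p * q) (p * r) = p" "gcd (p * q) (q * r) = q"
    using cop gcd_mult_distrib_nat[of r p q] gcd_mult_distrib_nat[of p q r] gcd_mult_distrib_nat[of q p r]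
    by (simp_all add: mult.commute coprime_iff_gcd_eq_1)
  have "unity_roots (p * r) \<inter> unity_roots (q * r) = unity_roots r"
    using unity_roots_inter[of "p * r" "q * r"] pos gcds by simp
  then have D: "root_poly ?D * unity_poly r = unity_poly (p * r) * unity_poly (q * r)"
    using root_poly_union_inter[OF fin(2,3)] pos by (simp add: root_poly_unity_roots)
  \<comment> \<open>Hence what the pq-th roots of unity add to \<open>?D\<close> is exactly the root
    set of \<open>R\<close>.\<close>
  have "unity_roots (p * q) \<inter> ?D = unity_roots p \<union> unity_roots q"
    using unity_roots_inter[of "p * q" "p * r"] unity_roots_inter[of "p * q" "q * r"] pos gcds
    by (simp add: Int_Un_distrib)
  then have "A = (unity_roots (p * q) - (unity_roots p \<union> unity_roots q)) \<union> ?D"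
      "(unity_roots (p * q) - (unity_roots p \<union> unity_roots q)) \<inter> ?D = {}"
    unfolding A_def by blast+
  then have "root_poly A = R * root_poly ?D"
    unfolding R_def binary_cyclotomic_def using fin by (metis finite_Diff finite_Un root_poly_disjoint_union)
  then have Q: "root_poly A * unity_poly r = R * unity_poly (p * r) * unity_poly (q * r)"
    using D by (simp only: mult.assoc)
  then show ?nonprimitive unfolding R_def .

  have X: "pcompose (unity_poly k) (monom 1 r) = unity_poly (r * k)" for k
    by (intro iffD1[OF poly_eq_poly_eq_iff] ext) (simp add: poly_pcompose poly_monom power_mult)
  let ?Rr = "pcompose R (monom 1 r)"
  \<comment> \<open>Substituting x^r into the product formula for \<Phi>_pq produces the binomials
    of the first two identities, which then allow cancellation.\<close>
  have "?Rr * unity_poly (r * p) * unity_poly (r * q) = unity_poly (r * 1) * unity_poly (r * (p * q))"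
    using arg_cong[OF binary_cyclotomic_mult[OF cop(1) pos(1,2)], of "\<lambda>f. pcompose f (monom 1 r)"]
    unfolding R_def pcompose_mult X .
  then have "?Rr * (unity_poly (p * r) * unity_poly (q * r)) = unity_poly r * (P * root_poly A)"
    unfolding full by (simp add: ac_simps)
  also have "\<dots> = P * R * (unity_poly (p * r) * unity_poly (q * r))"
    using arg_cong[OF Q, of "\<lambda>f. P * f"] by (simp only: ac_simps)
  finally have "?Rr = P * R"
    using unity_poly_nonzero[of "p * r"] unity_poly_nonzero[of "q * r"] pos by simp
  then show ?primitive unfolding P_def R_def by simp
qed

text \<open>At z, \<Psi> is the product of \<Phi>_pq(z), a geometric sum of \<open>p\<close> powers
  of z^r, and z^(qr) - 1. On the unit circle these have modulus at most pq, p and 2.\<close>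

lemma norm_poly_nonprimitive_le:
  assumes "coprime p q" "coprime p r" "coprime q r" "1 < p" "1 < q" "0 < r"
    and z: "norm z = 1" "z ^ r \<noteq> 1"
  shows "norm (poly (root_poly (unity_roots (p * q) \<union> (unity_roots (p * r) \<union> unity_roots (q * r)))) z)
    \<le> 2 * real p * real (p * q)"
proof -
  define Q where "Q = poly (root_poly (unity_roots (p * q) \<union> (unity_roots (p * r) \<union> unity_roots (q * r)))) z"
  define R where "R = poly (binary_cyclotomic p q) z"
  have pos: "0 < p" "0 < q" using assms by auto
  have geo: "z ^ (p * r) - 1 = (z ^ r - 1) * (\<Sum>i<p. (z ^ r) ^ i)"
    using power_diff_1_eq[of "z ^ r" p] by (simp add: power_mult mult.commute[of p r])
  have "Q * (z ^ r - 1) = R * (z ^ (p * r) - 1) * (z ^ (q * r) - 1)"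
    using arg_cong[OF ternary_root_poly_factors(2)[OF assms(1-3) pos assms(6)], of "\<lambda>f. poly f z"]
    unfolding Q_def R_def by (simp add: poly_monom)
  then have "Q = R * (\<Sum>i<p. (z ^ r) ^ i) * (z ^ (q * r) - 1)"
    unfolding geo using z(2) by simp
  moreover have "norm R \<le> real (p * q)"
  proof -
    have "norm R \<le> (real (degree (binary_cyclotomic p q)) + 1) * 1"
      unfolding R_def using coeff_binary_cyclotomic[OF assms(1) pos] z(1) by (intro norm_poly_le)
    also have "\<dots> \<le> real (p * q)"
      using degree_binary_cyclotomic[OF assms(1,4,5)] unfolding mult_1_right
      by (metis Suc_leI add.commute of_nat_Suc of_nat_le_iff)
    finally show ?thesis .
  qed
  moreover have "norm (\<Sum>i<p. (z ^ r) ^ i) \<le> real p"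
    using sum_norm_le[of "{..<p}" "\<lambda>i. (z ^ r) ^ i" "\<lambda>_. 1"] z(1) by (simp add: norm_power)
  moreover have "norm (z ^ (q * r) - 1) \<le> 2"
    using norm_triangle_ineq4[of "z ^ (q * r)" 1] z(1) by (simp add: norm_power)
  ultimately have "norm Q \<le> real (p * q) * real p * 2"
    by (simp only: norm_mult) (intro mult_mono mult_nonneg_nonneg; simp)
  then show ?thesis unfolding Q_def by (simp only: ac_simps)
qed

section \<open>Inverses of Vandermonde matrices\<close>

lemma frobenius_norm_le:
  assumes "A \<in> carrier_mat m m" "\<And>i j. i < m \<Longrightarrow> j < m \<Longrightarrow> norm (A $$ (i, j)) \<le> K" "0 \<le> K"
  shows "frobenius_norm A \<le> real m * K"
proof -
  have "(\<Sum>i<m. \<Sum>j<m. (norm (A $$ (i, j)))\<^sup>2) \<le> (\<Sum>i<m. \<Sum>j<m. K\<^sup>2)"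
    using assms by (intro sum_mono power_mono) auto
  also have "\<dots> = (real m * K)\<^sup>2" by (simp add: power2_eq_square)
  finally show ?thesis
    unfolding frobenius_norm_def using assms(1,3) by (intro real_le_lsqrt) auto
qed

text \<open>Synthetic division from the constant term upwards: since |z| = 1, each step adds at most
  \<open>H\<close> to the bound.\<close>

lemma coeff_quotient_linear_le:
  fixes B :: "'a::real_normed_field poly"
  assumes "norm z = 1" "\<And>k. norm (coeff ([:- z, 1:] * B) k) \<le> H"
  shows "norm (coeff B j) \<le> real (Suc j) * H"
proof (induction j)
  case 0
  show ?case using assms(2)[of 0] assms(1) by (simp add: norm_mult)
next
  case (Suc j)
  have "z * coeff B (Suc j) = coeff B j - coeff ([:- z, 1:] * B) (Suc j)"
    by simp
  then have "norm (coeff B (Suc j)) = norm (coeff B j - coeff ([:- z, 1:] * B) (Suc j))"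
    using assms(1) by (metis mult_1 norm_mult)
  also have "\<dots> \<le> norm (coeff B j) + norm (coeff ([:- z, 1:] * B) (Suc j))"
    by (rule norm_triangle_ineq4)
  also have "\<dots> \<le> real (Suc j) * H + H" using Suc assms(2) by (intro add_mono)
  finally show ?case by (simp add: algebra_simps)
qed

text \<open>The inverse consists of the coefficients of the Lagrange basis polynomials of the nodes,
  and \<open>K\<close> bounds its entries. The two Frobenius norms are then at most m and m
  K.\<close>

lemma cond_number_vandermonde_le:
  assumes inj: "inj_on \<zeta> {..<m}" and nodes: "\<And>i. i < m \<Longrightarrow> norm (\<zeta> i) = 1"
    and K: "0 \<le> K" "\<And>i j. i < m \<Longrightarrow> j < m \<Longrightarrow>
      norm (coeff (root_poly (\<zeta> ` {..<m} - {\<zeta> i})) j) \<le>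
      K * norm (poly (root_poly (\<zeta> ` {..<m} - {\<zeta> i})) (\<zeta> i))"
  shows "cond_number (vandermonde_mat m \<zeta>) \<le> real m ^ 2 * K"
proof -
  define L where "L = (\<lambda>i. root_poly (\<zeta> ` {..<m} - {\<zeta> i}))"
  define C where "C = mat m m (\<lambda>(j, i). coeff (L i) j / poly (L i) (\<zeta> i))"
  let ?V = "vandermonde_mat m \<zeta>"
  obtain B where B: "mat_inverse ?V = Some B" "B \<in> carrier_mat m m" "?V * B = 1\<^sub>m m" "B * ?V = 1\<^sub>m m"
    using vandermonde_mat_inverse[OF inj] .
  have V: "?V \<in> carrier_mat m m" by (simp add: vandermonde_mat_def)
  have C: "C \<in> carrier_mat m m" by (simp add: C_def)
  have deg: "degree (L i) < m" if "i < m" for i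
    using that inj by (simp add: L_def degree_root_poly card_image)
  have root: "poly (L i) (\<zeta> k) = 0 \<longleftrightarrow> k \<noteq> i" if "i < m" "k < m" for i k
    using that inj by (auto simp: L_def poly_root_poly inj_on_eq_iff)
  \<comment> \<open>Entry (k, i) of the product is the i-th Lagrange basis polynomial evaluated at
    the k-th node.\<close>
  have "?V * C = 1\<^sub>m m"
  proof (rule eq_matI)
    fix k i assume ki: "k < dim_row (1\<^sub>m m)" "i < dim_col (1\<^sub>m m)"
    have "(?V * C) $$ (k, i) = (\<Sum>j<m. \<zeta> k ^ j * (coeff (L i) j / poly (L i) (\<zeta> i)))"
      using ki by (simp add: C_def vandermonde_mat_def scalar_prod_def lessThan_atLeast0)
    also have "\<dots> = (\<Sum>j<m. coeff (L i) j * \<zeta> k ^ j) / poly (L i) (\<zeta> i)"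
      by (simp add: sum_divide_distrib mult.commute)
    also have "(\<Sum>j<m. coeff (L i) j * \<zeta> k ^ j) = poly (L i) (\<zeta> k)"
      unfolding poly_altdef using ki deg[of i]
      by (intro sum.mono_neutral_right) (auto simp: coeff_eq_0)
    finally show "(?V * C) $$ (k, i) = 1\<^sub>m m $$ (k, i)"
      using ki root[of i k] by (cases "k = i") auto
  qed (use V C in auto)
  then have "B = B * (?V * C)" using B(2) by simp
  also have "\<dots> = (B * ?V) * C" using B(2) V C by (simp add: assoc_mult_mat)
  also have "\<dots> = C" using B(4) C by simp
  finally have "B = C" .
  have "norm (C $$ (j, i)) \<le> K" if "j < m" "i < m" for j i
  proof -
    have "poly (L i) (\<zeta> i) \<noteq> 0" using root that by simp
    then show ?thesis
      using K(2)[of i j] that unfolding C_def L_def[symmetric]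
      by (simp add: norm_divide divide_le_eq L_def)
  qed
  then have "frobenius_norm C \<le> real m * K"
    using C K(1) by (intro frobenius_norm_le)
  moreover have "frobenius_norm ?V \<le> real m * 1"
    using V nodes by (intro frobenius_norm_le) (auto simp: vandermonde_mat_def norm_power)
  moreover have "0 \<le> frobenius_norm C"
    by (simp add: frobenius_norm_def sum_nonneg)
  ultimately have "frobenius_norm ?V * frobenius_norm C \<le> (real m * 1) * (real m * K)"
    by (intro mult_mono) auto
  then show ?thesis
    using B(1) \<open>B = C\<close> by (simp add: cond_number_def power2_eq_square ac_simps)
qed

section \<open>The condition number for a product of three odd primes\<close>

theorem proposition4p5:
  fixes p q r n m :: nat and \<zeta> :: "nat \<Rightarrow> complex"
  assumes "prime p" "prime q" "prime r"
    and "odd p" "odd q" "odd r"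
    and "p < q" "q < r"
    and "n = p * q * r"
    and "m = totient n"
    and "bij_betw \<zeta> {..<m} (primitive_roots_of_unity n)"
  shows "cond_number (vandermonde_mat m \<zeta>) \<le> 2 * real m ^ 4"
proof -
  have cop: "coprime p q" "coprime p r" "coprime q r"
    using assms(1-3,7,8) by (simp_all add: primes_coprime)
  have gt: "1 < p" "1 < q" "1 < r"
    using assms(1-3) prime_gt_1_nat by auto
  have pos: "0 < p" "0 < q" "0 < r" "0 < n" using gt assms(9) by auto
  define A where "A = unity_roots (p * q) \<union> (unity_roots (p * r) \<union> unity_roots (q * r))"
  define P where "P = root_poly (unity_roots n - A)"
  have prim: "primitive_roots_of_unity n = unity_roots n - A"
    unfolding A_def assms(9) by (rule primitive_roots_of_unity_three_primes[OF assms(1-3)])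
  have img: "\<zeta> ` {..<m} = unity_roots n - A"
    using assms(11) unfolding prim by (simp add: bij_betw_def)
  have inj: "inj_on \<zeta> {..<m}"
    using assms(11) by (simp add: bij_betw_def)
  have mem: "\<zeta> i ^ n = 1" "\<zeta> i \<notin> A" if "i < m" for i
    using img that by blast+
  have unit: "norm (\<zeta> i) = 1" if "i < m" for i
    using mem(1)[OF that] pos(4) by (metis norm_ge_zero norm_one norm_power power_eq_1_iff zero_less_iff_neq_zero)
  have H: "norm (coeff P k) \<le> real (p * q)" for k
    unfolding P_def A_def assms(9)
    by (rule coeff_ternary_cyclotomic[OF cop(1) gt(1,2) pos(3)
          ternary_root_poly_factors(3)[OF cop pos(1-3)]])
  have m: "m = (p - 1) * (q - 1) * (r - 1)"
    unfolding assms(9,10) using cop assms(1-3) by (simp add: totient_mult_coprime totient_prime)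
  \<comment> \<open>Replacing p and q by p - 1 and q - 1 costs at most a factor 2 each, and r - 1
    \<ge> 4 pays for both.\<close>
  have pqm: "p * q \<le> m"
  proof -
    have "p \<noteq> 2" "q \<noteq> 2" using assms(4,5) by auto
    then have "5 \<le> r" "p \<le> 2 * (p - 1)" "q \<le> 2 * (q - 1)" using gt assms(7,8) by linarith+
    then have "p * q \<le> (2 * (p - 1)) * (2 * (q - 1))" by (intro mult_le_mono)
    also have "\<dots> = (p - 1) * (q - 1) * 4" by simp
    also have "\<dots> \<le> m" unfolding m using \<open>5 \<le> r\<close> by (intro mult_le_mono) auto
    finally show ?thesis .
  qed
  \<comment> \<open>An entry of the inverse is at most (m pq)(2p pq) / n, from the bounds on the
    coefficients of \<open>L\<close> and on \<open>Q\<close>; the inequality p (pq)^2 \<le> n m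
    turns this into 2 m^2.\<close>
  define K where "K = 2 * real m ^ 2"
  have "norm (coeff (root_poly (\<zeta> ` {..<m} - {\<zeta> i})) j) \<le>
      K * norm (poly (root_poly (\<zeta> ` {..<m} - {\<zeta> i})) (\<zeta> i))" if ij: "i < m" "j < m" for i j
  proof -
    define z where "z = \<zeta> i"
    define L where "L = root_poly (\<zeta> ` {..<m} - {z})"
    define Q where "Q = poly (root_poly A) z"
    have z: "z ^ n = 1" "z \<notin> A" "norm z = 1" using mem unit ij unfolding z_def by auto
    have PL: "P = [:- z, 1:] * L"
      unfolding P_def L_def img[symmetric] z_def using ij by (intro root_poly_remove) auto
    have "norm (coeff L j) \<le> real (Suc j) * real (p * q)"
      using H z(3) unfolding PL by (intro coeff_quotient_linear_le)
    also have "\<dots> \<le> real m * real (p * q)" using ij by (intro mult_right_mono) auto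
    finally have num: "norm (coeff L j) \<le> real m * real (p * q)" .
    have "z ^ r \<noteq> 1" using z(2) unfolding A_def by (auto simp: power_mult mult.commute[of _ r])
    then have Q: "norm Q \<le> 2 * real p * real (p * q)"
      unfolding Q_def A_def using z(3) by (intro norm_poly_nonprimitive_le cop gt pos)
    \<comment> \<open>Differentiating \<open>(x - z) L(x) Q(x) = x\<^sup>n - 1\<close> at \<open>z\<close> gives \<open>L(z) Q(z) = n z\<^bsup>n-1\<^esup>\<close>.\<close>
    have "[:- z, 1:] * (L * root_poly A) = unity_poly n"
      using ternary_root_poly_factors(1)[OF cop pos(1-3)] PL
      unfolding P_def A_def assms(9) by (metis mult.assoc)
    from arg_cong[OF this, of "\<lambda>f. poly (pderiv f) z"]
    have "poly L z * Q = of_nat n * z ^ (n - 1)"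
      unfolding Q_def pderiv_mult poly_add poly_mult
      by (simp add: pderiv_diff pderiv_pCons pderiv_monom poly_monom)
    from arg_cong[OF this, of norm]
    have LQ: "norm (poly L z) * norm Q = real n" using z(3) by (simp add: norm_mult norm_power)
    \<comment> \<open>Writing n as |L(z)| |Q| lets the upper bound on \<open>Q\<close> serve as a
      lower bound on L(z) without division.\<close>
    have "real n * (real m * real (p * q)) \<le> real n * (K * norm (poly L z))"
    proof -
      have *: "real p * real (p * q) * real (p * q) \<le> real n * real m"
      proof -
        \<comment> \<open>One factor pq joins p \<le> r to give n, the other is at most m.\<close>
        have "p * (p * q) * (p * q) \<le> (r * (p * q)) * m"
          using assms(7,8) pqm by (intro mult_le_mono) auto
        then show ?thesis unfolding assms(9) of_nat_mult[symmetric] of_nat_le_iff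
          by (simp only: ac_simps)
      qed
      have "real n * (real m * real (p * q)) = norm (poly L z) * real m * (norm Q * real (p * q))"
        unfolding LQ[symmetric] by (simp only: ac_simps)
      also have "\<dots> \<le> norm (poly L z) * real m * ((2 * real p * real (p * q)) * real (p * q))"
        using Q by (intro mult_left_mono mult_right_mono) auto
      also have "\<dots> = norm (poly L z) * real m * 2 * (real p * real (p * q) * real (p * q))"
        by (simp only: ac_simps)
      also have "\<dots> \<le> norm (poly L z) * real m * 2 * (real n * real m)"
        using * by (intro mult_left_mono) auto
      also have "\<dots> = real n * (K * norm (poly L z))"
        unfolding K_def power2_eq_square by (simp only: ac_simps)
      finally show ?thesis .
    qed
    then have "real m * real (p * q) \<le> K * norm (poly L z)" using pos(4) by simp
    then show ?thesis using num unfolding L_def z_def by linarith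
  qed
  then have "cond_number (vandermonde_mat m \<zeta>) \<le> real m ^ 2 * K"
    using inj unit by (intro cond_number_vandermonde_le) (auto simp: K_def)
  then show ?thesis by (simp add: K_def power2_eq_square power4_eq_xxxx ac_simps)
qed

end
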